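(* Let $M,B_y>0$, $n,m,d,d_h\in\mathbb N$, $X=[-M,M]^n$, and let $u_i\in\mathbb R^d$ and $q_i\in\{1,\dots,m\}$, $i=1,\dots,n$. Let $\omega(t):=(1+e^{-t})^{-1}$. For $$y=(A,a,V,b)\in Y\subseteq\mathbb R^{d_h\times d}\times\mathbb R^{d_h}\times\mathbb R^{m\times d_h}\times\mathbb R^m,$$ define $h_y(u):=V\operatorname{sigm}(Au+a)+b$, where $\operatorname{sigm}$ is the logistic sigmoid $t\mapsto(1+e^{-t})^{-1}$ applied componentwise, and set $\ell_i(y):=\ell(h_y(u_i),q_i)$, where $\ell(s,q):=\log\bigl(\sum_{j=1}^me^{s_j}\bigr)-s_q$ for $s\in\mathbb R^m$. Suppose $Y$ is nonempty, compact and convex, and that for every $y=(A,a,V,b)\in Y$ every component of $V$ and $b$ lies in $[-B_y,B_y]$. Let $$g(x,y)=\frac1n\sum_{i=1}^n\omega(x_i)\,\ell_i(y).$$ If $$\delta>\frac{2B_y(d_h+1)+\log m}{1+e^M},$$ then ENNAMCQ holds on $X\times Y$, i.e. $0\notin\nabla R(w)+N_C(w)$ for every $w\in C=X\times Y$ with $R(w)\ge0$.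
   Context: $\sigma\ge0$ is such that $g(x,\cdot)+\frac\sigma2\|\cdot\|^2$ is convex on $Y$ for every $x\in X$, and $\rho>0$ satisfies $\rho\sigma<1$. Put $g_\rho(x,y)=\min_{z\in Y}\{g(x,z)+\frac1{2\rho}\|z-y\|^2\}$, with unique minimizer $z_\rho(x,y)$, and $R(x,y)=g(x,y)-g_\rho(x,y)-\delta$. $R$ is continuously differentiable on $C$ with $\nabla R(x,y)=\bigl(\nabla_xg(x,y)-\nabla_xg(x,z_\rho(x,y)),\ \nabla_yg(x,y)-\rho^{-1}(y-z_\rho(x,y))\bigr)$. $N_C$ denotes the normal cone to $C$ in the sense of convex analysis. *)

theory Defs
  imports "HOL-Analysis.Analysis"
begin

definition normal_cone :: "'a::real_inner set \<Rightarrow> 'a \<Rightarrow> 'a set" where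
  "normal_cone C w = {v. w \<in> C \<and> (\<forall>u\<in>C. v \<bullet> (u - w) \<le> 0)}"

text \<open>The Frechet gradient with respect to the whole ambient space; the set \<open>C\<close> on which it is
  evaluated may have empty interior.\<close>

definition gradient :: "('a::real_inner \<Rightarrow> real) \<Rightarrow> 'a \<Rightarrow> 'a" where
  "gradient f w = (THE v. GDERIV f w :> v)"

lemma gradient_eqI:
  assumes "GDERIV f w :> v"
  shows "gradient f w = v"
  unfolding gradient_def
proof (rule the_equality, rule assms)
  fix u assume "GDERIV f w :> u"
  with assms have "(\<lambda>h. h \<bullet> u) = (\<lambda>h. h \<bullet> v)"
    unfolding gderiv_def by (blast intro: has_derivative_unique)
  then have "(u - v) \<bullet> u = (u - v) \<bullet> v" by meson
  then have "(u - v) \<bullet> (u - v) = 0" by (simp add: inner_diff_right)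
  then show "u = v" by simp
qed

text \<open>The expression \<open>0 \<notin> \<nabla>R(w) + N\<^sub>C(w)\<close> presupposes that \<open>R\<close> is differentiable at \<open>w\<close>.
  This is demanded explicitly, since otherwise \<^const>\<open>gradient\<close> is an unspecified value.\<close>

definition ennamcq :: "('a::real_inner \<Rightarrow> real) \<Rightarrow> 'a set \<Rightarrow> bool" where
  "ennamcq R C \<longleftrightarrow>
     (\<forall>w\<in>C. R w \<ge> 0 \<longrightarrow>
        R differentiable (at w) \<and> 0 \<notin> (\<lambda>v. gradient R w + v) ` normal_cone C w)"

text \<open>For nonempty compact \<open>Y\<close> and continuous \<open>g x\<close> the infimum is attained, so it is the minimum.\<close>

definition moreau_env ::
    "('a \<Rightarrow> 'b::real_normed_vector \<Rightarrow> real) \<Rightarrow> 'b set \<Rightarrow> real \<Rightarrow> 'a \<Rightarrow> 'b \<Rightarrow> real" where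
  "moreau_env g Y \<rho> x y = (INF z\<in>Y. g x z + 1 / (2 * \<rho>) * (norm (z - y))\<^sup>2)"

definition moreau_gap ::
    "('a \<Rightarrow> 'b::real_normed_vector \<Rightarrow> real) \<Rightarrow> 'b set \<Rightarrow> real \<Rightarrow> real \<Rightarrow> 'a \<times> 'b \<Rightarrow> real" where
  "moreau_gap g Y \<rho> \<delta> = (\<lambda>(x, y). g x y - moreau_env g Y \<rho> x y - \<delta>)"

definition logistic :: "real \<Rightarrow> real" where
  "logistic t = 1 / (1 + exp (- t))"

text \<open>Parameters \<open>(A, a, V, b)\<close>, with \<open>'d\<close>, \<open>'h\<close>, \<open>'m\<close> indexing inputs, hidden units and classes.
  The norm of this product type is the Euclidean norm of all entries.\<close>

type_synonym ('d, 'h, 'm) params =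
  "(real ^ 'd ^ 'h) \<times> (real ^ 'h) \<times> (real ^ 'h ^ 'm) \<times> (real ^ 'm)"

definition network ::
    "('d::finite, 'h::finite, 'm::finite) params \<Rightarrow> real ^ 'd \<Rightarrow> real ^ 'm" where
  "network = (\<lambda>(A, a, V, b) u. V *v (\<chi> k. logistic ((A *v u + a) $ k)) + b)"

definition cross_entropy :: "real ^ 'm::finite \<Rightarrow> 'm \<Rightarrow> real" where
  "cross_entropy s q = ln (\<Sum>j\<in>UNIV. exp (s $ j)) - s $ q"

definition weighted_loss ::
    "('n::finite \<Rightarrow> real ^ 'd::finite) \<Rightarrow> ('n \<Rightarrow> 'm::finite) \<Rightarrow>
     real ^ 'n \<Rightarrow> ('d, 'h::finite, 'm) params \<Rightarrow> real" where
  "weighted_loss u q x y =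
     1 / real CARD('n) * (\<Sum>i\<in>UNIV. logistic (x $ i) * cross_entropy (network y (u i)) (q i))"

end

theory Submission
  imports Defs
begin

text \<open>
  Weak convexity makes the proximal minimizer \<open>z\<close> at \<open>(x, y)\<close> unique, so Danskin's theorem gives
  differentiability of \<open>R\<close>, even across the boundary of \<open>X \<times> Y\<close>.  The contradiction uses only the
  \<open>x\<close>-part of stationarity: the \<open>i\<close>-th component of the \<open>x\<close>-gradient of \<open>R\<close> is a positive multiple of
  \<open>\<ell>\<^sub>i(y) - \<ell>\<^sub>i(z)\<close>, so wherever this difference is positive, \<open>x\<^sub>i = - M\<close> and the weight
  \<open>\<omega>(x\<^sub>i)\<close> is only \<open>1 / (1 + exp M)\<close>.  Hence \<open>g(x, y) - g(x, z)\<close> is at most the maximal loss divided by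
  \<open>1 + exp M\<close>, which is below \<open>\<delta>\<close>, whereas \<open>R(x, y) \<ge> 0\<close> forces it to be at least \<open>\<delta>\<close>.
\<close>

section \<open>Gradients of infima over a compact set\<close>

lemma GDERIV_exists:
  fixes f :: "'a::euclidean_space \<Rightarrow> real"
  assumes "(f has_derivative D) (at w)"
  obtains v where "GDERIV f w :> v" and "\<And>h. h \<bullet> v = D h"
proof
  have "linear D"
    using assms by (rule has_derivative_linear)
  then show eq: "h \<bullet> adjoint D 1 = D h" for h
    by (simp add: adjoint_works)
  show "GDERIV f w :> adjoint D 1"
    using assms by (simp add: gderiv_def eq)
qed

text \<open>Linearizing \<open>f\<close> in \<open>w\<close> at \<open>w0\<close> has an error that
  is uniform over the compact set \<open>Z\<close>. Inserting \<open>z0\<close> then bounds the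
  infimum from above. From below, points near \<open>z0\<close> have almost the slope
  \<open>G w0 z0\<close>, while all others start too far above the minimum for a small change of
  \<open>w\<close> to make up.\<close>

lemma Danskin_unique_minimizer:
  fixes f :: "'a::euclidean_space \<Rightarrow> 'b::metric_space \<Rightarrow> real"
  assumes "compact Z" and "z0 \<in> Z"
    and cont: "continuous_on Z (f w0)"
    and deriv: "\<And>w z. z \<in> Z \<Longrightarrow> GDERIV (\<lambda>w. f w z) w :> G w z"
    and contG: "continuous_on (UNIV \<times> Z) (\<lambda>(w, z). G w z)"
    and unique: "\<And>z. z \<in> Z \<Longrightarrow> z \<noteq> z0 \<Longrightarrow> f w0 z0 < f w0 z"
  shows "GDERIV (\<lambda>w. INF z\<in>Z. f w z) w0 :> G w0 z0"
proof -
  define \<phi> where "\<phi> = (\<lambda>w. INF z\<in>Z. f w z)"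
  \<comment> \<open>On a small ball \<open>G w z\<close> stays close to \<open>G w0 z\<close>,
    uniformly in \<open>z\<close>; the mean value inequality along the segment from
    \<open>w0\<close> to \<open>w\<close> turns this into a linearization error.\<close>
  have unif: "\<exists>d>0. \<forall>w z. norm (w - w0) \<le> d \<longrightarrow> z \<in> Z \<longrightarrow>
      \<bar>f w z - f w0 z - (w - w0) \<bullet> G w0 z\<bar> \<le> e * norm (w - w0)" if "e > 0" for e
  proof -
    have "uniformly_continuous_on (cball w0 1 \<times> Z) (\<lambda>(w, z). G w z)"
      by (intro compact_uniformly_continuous compact_Times compact_cball \<open>compact Z\<close>
          continuous_on_subset[OF contG]) auto
    then obtain d where "d > 0" and d: "\<And>p p'. p \<in> cball w0 1 \<times> Z \<Longrightarrow> p' \<in> cball w0 1 \<times> Z \<Longrightarrow>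
        dist p' p < d \<Longrightarrow> dist (case p' of (w, z) \<Rightarrow> G w z) (case p of (w, z) \<Rightarrow> G w z) < e"
      unfolding uniformly_continuous_on_def using \<open>e > 0\<close> by metis
    \<comment> \<open>The cap \<open>1\<close> keeps to the ball on which \<open>G\<close> is
      uniformly continuous; \<open>d / 2\<close> gives strict distance below \<open>d\<close> on the
      closed ball.\<close>
    define r where "r = min 1 (d / 2)"
    have r: "r > 0" "r \<le> 1" "r < d"
      using \<open>d > 0\<close> by (auto simp: r_def)
    have near: "norm (G w z - G w0 z) \<le> e" if "w \<in> cball w0 r" "z \<in> Z" for w z
    proof -
      have "dist (w, z) (w0, z) < d"
        using that r by (auto simp: dist_Pair_Pair dist_commute)
      then show ?thesis
        using d[of "(w0, z)" "(w, z)"] that r by (auto simp: dist_norm)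
    qed
    have "\<bar>f w z - f w0 z - (w - w0) \<bullet> G w0 z\<bar> \<le> e * norm (w - w0)"
      if "norm (w - w0) \<le> r" "z \<in> Z" for w z
    proof -
      have "norm (f w z - f w0 z - (w - w0) \<bullet> G w0 z) \<le> norm (w - w0) * e"
      proof (rule differentiable_bound_linearization[where S = "cball w0 r" and f = "\<lambda>w. f w z" 
              and f' = "\<lambda>w h. h \<bullet> G w z"])
        show "w0 + t *\<^sub>R (w - w0) \<in> cball w0 r" if "t \<in> {0..1}" for t
        proof -
          have "norm (t *\<^sub>R (w - w0)) \<le> 1 * norm (w - w0)"
            using that by (simp add: mult_left_le_one_le)
          with \<open>norm (w - w0) \<le> r\<close> show ?thesis by (simp add: dist_norm)
        qed
        show "((\<lambda>w. f w z) has_derivative (\<lambda>h. h \<bullet> G w z)) (at w within cball w0 r)" for w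
          using deriv[OF \<open>z \<in> Z\<close>] unfolding gderiv_def by (rule has_derivative_at_withinI)
        show "onorm ((\<lambda>h. h \<bullet> G w z) - (\<lambda>h. h \<bullet> G w0 z)) \<le> e" if "w \<in> cball w0 r" for w
        proof (rule onorm_le)
          fix h
          have "norm (h \<bullet> (G w z - G w0 z)) \<le> norm h * norm (G w z - G w0 z)"
            by (rule Cauchy_Schwarz_ineq2[folded real_norm_def])
          also have "\<dots> \<le> norm h * e"
            by (intro mult_left_mono near that \<open>z \<in> Z\<close>) auto
          finally show "norm (((\<lambda>h. h \<bullet> G w z) - (\<lambda>h. h \<bullet> G w0 z)) h) \<le> e * norm h"
            by (simp add: inner_diff_right mult.commute)
        qed
      qed (use r in auto)
      then show ?thesis by (simp add: mult.commute)
    qed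
    with \<open>r > 0\<close> show ?thesis by blast
  qed
  have contG0: "continuous_on Z (G w0)"
  proof -
    have "continuous_on Z (\<lambda>z. case (w0, z) of (w, z) \<Rightarrow> G w z)"
      by (rule continuous_on_compose2[OF contG]) (auto intro!: continuous_intros)
    then show ?thesis by simp
  qed
  \<comment> \<open>Any two slopes at \<open>w0\<close> differ by at most \<open>2 * K\<close>,
    which limits how fast a distant \<open>z\<close> can overtake \<open>z0\<close>.\<close>
  obtain K where K: "\<And>z. z \<in> Z \<Longrightarrow> norm (G w0 z) \<le> K"
    using compact_imp_bounded[OF compact_continuous_image[OF contG0 \<open>compact Z\<close>]]
    unfolding bounded_iff by auto
  have "K \<ge> 0"
    using K[OF \<open>z0 \<in> Z\<close>] norm_ge_zero order_trans by blast
  have min: "f w0 z0 \<le> f w0 z" if "z \<in> Z" for z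
    using unique[OF that] by (cases "z = z0") auto
  have \<phi>0: "\<phi> w0 = f w0 z0"
    unfolding \<phi>_def by (rule cInf_eq_minimum) (use \<open>z0 \<in> Z\<close> min in auto)
  have "\<exists>d>0. \<forall>w. norm (w - w0) < d \<longrightarrow>
      norm (\<phi> w - \<phi> w0 - (w - w0) \<bullet> G w0 z0) \<le> e * norm (w - w0)" if "e > 0" for e
  proof -
    obtain d1 where "d1 > 0" and d1: "\<And>w z. norm (w - w0) \<le> d1 \<Longrightarrow> z \<in> Z \<Longrightarrow>
        \<bar>f w z - f w0 z - (w - w0) \<bullet> G w0 z\<bar> \<le> e / 2 * norm (w - w0)"
      using unif[of "e / 2"] \<open>e > 0\<close> by auto
    obtain d2 where "d2 > 0" and d2: "\<And>z. z \<in> Z \<Longrightarrow> dist z z0 < d2 \<Longrightarrow> dist (G w0 z) (G w0 z0) < e / 2"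
      using contG0 \<open>z0 \<in> Z\<close> \<open>e > 0\<close> unfolding continuous_on_iff by (metis half_gt_zero)
    \<comment> \<open>Away from \<open>z0\<close> the values exceed the minimum by a fixed gap:
      \<open>f w0\<close> attains its infimum on the compact remainder, and uniqueness makes it
      strictly larger. If nothing remains, any positive gap will do.\<close>
    obtain \<eta> where "\<eta> > 0" and \<eta>: "\<And>z. z \<in> Z \<Longrightarrow> dist z z0 \<ge> d2 \<Longrightarrow> f w0 z \<ge> f w0 z0 + \<eta>"
    proof (cases "Z - ball z0 d2 = {}")
      case True
      then show ?thesis using that[of 1] by (force simp: dist_commute)
    next
      case False
      have "compact (Z - ball z0 d2)"
        using \<open>compact Z\<close> by (simp add: compact_diff)
      then obtain z1 where z1: "z1 \<in> Z - ball z0 d2" "\<And>z. z \<in> Z - ball z0 d2 \<Longrightarrow> f w0 z1 \<le> f w0 z"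
        using continuous_attains_inf[OF _ False continuous_on_subset[OF cont]] by auto
      show ?thesis
      proof (rule that)
        have "z1 \<noteq> z0" using z1(1) \<open>d2 > 0\<close> by auto
        then show "0 < f w0 z1 - f w0 z0" using unique[of z1] z1(1) by auto
        show "f w0 z0 + (f w0 z1 - f w0 z0) \<le> f w0 z" if "z \<in> Z" "dist z z0 \<ge> d2" for z
          using z1(2)[of z] that by (auto simp: dist_commute)
      qed
    qed
    \<comment> \<open>The second bound keeps the change of slope, at most \<open>2 * K\<close> times
      the displacement, below the gap; the \<open>+ 1\<close> avoids a zero denominator when
      \<open>K = 0\<close>.\<close>
    define d where "d = min d1 (\<eta> / (2 * K + 1))"
    have "d > 0" using \<open>d1 > 0\<close> \<open>\<eta> > 0\<close> \<open>K \<ge> 0\<close> by (auto simp: d_def)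
    moreover have "norm (\<phi> w - \<phi> w0 - (w - w0) \<bullet> G w0 z0) \<le> e * norm (w - w0)"
      if w: "norm (w - w0) < d" for w
    proof -
      let ?n = "norm (w - w0)"
      have "?n \<le> d1" "?n < \<eta> / (2 * K + 1)" using w by (auto simp: d_def)
      then have small: "2 * K * ?n + ?n \<le> \<eta>"
        using \<open>K \<ge> 0\<close> by (simp add: field_simps)
      \<comment> \<open>Near \<open>z0\<close>, half of \<open>e\<close> pays for the linearization
        and half for the variation of the slope. Far from \<open>z0\<close>, the gap pays for the
        slope.\<close>
      have low: "f w0 z0 + (w - w0) \<bullet> G w0 z0 - e * ?n \<le> f w z" if "z \<in> Z" for z
      proof (cases "dist z z0 < d2")
        case True
        have "\<bar>(w - w0) \<bullet> (G w0 z - G w0 z0)\<bar> \<le> ?n * norm (G w0 z - G w0 z0)"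
          by (rule Cauchy_Schwarz_ineq2)
        also have "\<dots> \<le> ?n * (e / 2)"
          using d2[OF that True] by (intro mult_left_mono) (auto simp: dist_norm)
        finally have "\<bar>(w - w0) \<bullet> G w0 z - (w - w0) \<bullet> G w0 z0\<bar> \<le> e / 2 * ?n"
          by (simp add: inner_diff_right mult.commute)
        moreover have "e / 2 * ?n = e * ?n / 2" by simp
        ultimately show ?thesis
          using d1[OF \<open>?n \<le> d1\<close> that] min[OF that] by linarith
      next
        case False
        have "\<bar>(w - w0) \<bullet> (G w0 z - G w0 z0)\<bar> \<le> ?n * norm (G w0 z - G w0 z0)"
          by (rule Cauchy_Schwarz_ineq2)
        also have "\<dots> \<le> ?n * (2 * K)"
          using norm_triangle_ineq4[of "G w0 z" "G w0 z0"] K[OF that] K[OF \<open>z0 \<in> Z\<close>]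
          by (intro mult_left_mono) auto
        also have "\<dots> = 2 * K * ?n" by simp
        also have "\<dots> \<le> \<eta>" using small norm_ge_zero[of "w - w0"] by linarith
        finally have "\<bar>(w - w0) \<bullet> G w0 z - (w - w0) \<bullet> G w0 z0\<bar> \<le> \<eta>"
          by (simp add: inner_diff_right)
        moreover have "e / 2 * ?n \<le> e * ?n"
          using \<open>e > 0\<close> by (intro mult_right_mono) auto
        moreover have "f w0 z0 + \<eta> \<le> f w0 z"
          using \<eta>[OF that] False by simp
        ultimately show ?thesis
          using d1[OF \<open>?n \<le> d1\<close> that] by linarith
      qed
      \<comment> \<open>The lower bound passes to the infimum because it does not depend on
        \<open>z\<close>. It also supplies the boundedness below that is required for comparing the
        infimum with the value at \<open>z0\<close>.\<close>
      have "f w0 z0 + (w - w0) \<bullet> G w0 z0 - e * ?n \<le> \<phi> w"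
        unfolding \<phi>_def using \<open>z0 \<in> Z\<close> low by (intro cINF_greatest) auto
      moreover have "\<phi> w \<le> f w z0"
        unfolding \<phi>_def using \<open>z0 \<in> Z\<close> low by (intro cINF_lower bdd_belowI2) auto
      moreover have "e / 2 * ?n \<le> e * ?n"
        using \<open>e > 0\<close> by (intro mult_right_mono) auto
      ultimately show ?thesis
        using d1[OF \<open>?n \<le> d1\<close> \<open>z0 \<in> Z\<close>] \<phi>0 unfolding real_norm_def by linarith
    qed
    ultimately show ?thesis by blast
  qed
  then show ?thesis
    unfolding gderiv_def has_derivative_at_alt \<phi>_def[symmetric]
    by (auto intro: bounded_linear_inner_left)
qed

section \<open>Bounds and differentiability of the network loss\<close>

lemma differentiable_compose_DERIV:
  assumes "(f has_real_derivative c) (at (h w))" and "h differentiable (at w)"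
  shows "(\<lambda>w. f (h w)) differentiable (at w)"
  using assms has_derivative_compose[OF _ has_field_derivative_imp_has_derivative]
  unfolding differentiable_def by blast

lemma logistic_pos: "0 < logistic t" and logistic_le_1: "logistic t \<le> 1"
  by (auto simp: logistic_def field_simps add_pos_pos)

lemma logistic_DERIV:
  "(logistic has_real_derivative logistic t * (1 - logistic t)) (at t)"
proof -
  have "1 + exp (- t) \<noteq> 0" using exp_gt_zero[of "- t"] by linarith
  then have "((\<lambda>t. 1 / (1 + exp (- t))) has_real_derivative logistic t * (1 - logistic t)) (at t)"
    by (auto intro!: derivative_eq_intros simp: logistic_def field_simps power2_eq_square)
  then show ?thesis by (simp add: logistic_def[abs_def])
qed

lemma continuous_on_logistic [continuous_intros]:
  "continuous_on S f \<Longrightarrow> continuous_on S (\<lambda>x. logistic (f x))"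
  using continuous_on_compose2[of UNIV logistic S f]
    DERIV_continuous_on[OF has_field_derivative_at_within[OF logistic_DERIV]] by auto

lemma cross_entropy_nonneg: "0 \<le> cross_entropy s q"
proof -
  have "exp (s $ q) \<le> (\<Sum>j\<in>UNIV. exp (s $ j))"
    by (rule member_le_sum) auto
  then have "ln (exp (s $ q)) \<le> ln (\<Sum>j\<in>UNIV. exp (s $ j))"
    by (intro ln_mono) auto
  then show ?thesis by (simp add: cross_entropy_def)
qed

text \<open>The logarithm of the exponential sum contributes at most \<open>B\<close> plus the
  logarithm of the number of classes, and the subtracted score contributes another
  \<open>B\<close>.\<close>

lemma cross_entropy_le:
  fixes s :: "real ^ 'm::finite"
  assumes "\<And>j. \<bar>s $ j\<bar> \<le> B"
  shows "cross_entropy s q \<le> 2 * B + ln (real CARD('m))"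
proof -
  have "exp (s $ j) \<le> exp B" for j using assms[of j] by simp
  then have "(\<Sum>j\<in>UNIV. exp (s $ j)) \<le> real CARD('m) * exp B"
    by (rule sum_bounded_above)
  moreover have "0 < (\<Sum>j\<in>UNIV. exp (s $ j))"
    by (intro sum_pos) auto
  ultimately have "ln (\<Sum>j\<in>UNIV. exp (s $ j)) \<le> ln (real CARD('m) * exp B)"
    by (intro ln_mono) auto
  also have "\<dots> = ln (real CARD('m)) + B" by (simp add: ln_mult)
  finally show ?thesis using assms[of q] by (simp add: cross_entropy_def)
qed

text \<open>Activations lie between 0 and 1, so each hidden unit contributes at most
  \<open>B\<close>; the bias accounts for the additional \<open>1\<close>.\<close>

lemma abs_network_le:
  fixes V :: "real ^ 'h::finite ^ 'm::finite"
  assumes "\<And>j k. \<bar>V $ j $ k\<bar> \<le> B" and "\<And>j. \<bar>b $ j\<bar> \<le> B"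
  shows "\<bar>network (A, a, V, b) u $ j\<bar> \<le> B * (real CARD('h) + 1)"
proof -
  define t where "t = (\<lambda>k. logistic ((A *v u + a) $ k))"
  have "\<bar>V $ j $ k * t k\<bar> \<le> B" for k
  proof -
    have "\<bar>V $ j $ k\<bar> * t k \<le> \<bar>V $ j $ k\<bar> * 1"
      by (intro mult_left_mono) (auto simp: t_def logistic_le_1)
    with assms(1)[of j k] show ?thesis
      by (simp add: abs_mult t_def abs_of_pos[OF logistic_pos])
  qed
  then have "(\<Sum>k\<in>UNIV. \<bar>V $ j $ k * t k\<bar>) \<le> real CARD('h) * B"
    by (rule sum_bounded_above)
  then have "\<bar>\<Sum>k\<in>UNIV. V $ j $ k * t k\<bar> \<le> real CARD('h) * B"
    using sum_abs[of "\<lambda>k. V $ j $ k * t k" UNIV] by linarith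
  moreover have "network (A, a, V, b) u $ j = (\<Sum>k\<in>UNIV. V $ j $ k * t k) + b $ j"
    by (simp add: network_def t_def matrix_vector_mult_def)
  ultimately show ?thesis
    using assms(2)[of j] by (auto simp: field_simps)
qed

lemma network_differentiable:
  "(\<lambda>y. network y u $ j) differentiable (at y)"
proof -
  \<comment> \<open>In coordinates only sums, products and logistic functions of parameter entries
    appear, and each entry is a bounded linear projection.\<close>
  have eq: "(\<lambda>y. network y u $ j) = (\<lambda>y. (\<Sum>k\<in>UNIV. fst (snd (snd y)) $ j $ k *
      logistic ((\<Sum>l\<in>UNIV. fst y $ k $ l * u $ l) + fst (snd y) $ k)) + snd (snd (snd y)) $ j)"
    by (auto simp: network_def matrix_vector_mult_def)
  have lin: "L differentiable (at y)" if "bounded_linear L" for L :: "_ \<Rightarrow> real"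
    using that by (rule bounded_linear_imp_differentiable)
  show ?thesis
    unfolding eq
    by (intro differentiable_add differentiable_sum differentiable_mult differentiable_compose_DERIV[OF logistic_DERIV]
        differentiable_const lin ballI finite
        bounded_linear_vec_nth[THEN bounded_linear_compose]
        bounded_linear_fst[THEN bounded_linear_compose]
        bounded_linear_snd[THEN bounded_linear_compose] bounded_linear_fst bounded_linear_snd)
qed

lemma cross_entropy_network_differentiable:
  "(\<lambda>y. cross_entropy (network y u) q) differentiable (at y)"
proof -
  have "(\<lambda>y. exp (network y u $ j)) differentiable (at y)" for j
    by (rule differentiable_compose_DERIV[OF DERIV_exp network_differentiable])
  then have "(\<lambda>y. \<Sum>j\<in>UNIV. exp (network y u $ j)) differentiable (at y)"
    by (intro differentiable_sum) auto
  moreover have "0 < (\<Sum>j\<in>UNIV. exp (network y u $ j))"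
    by (intro sum_pos) auto
  ultimately have "(\<lambda>y. ln (\<Sum>j\<in>UNIV. exp (network y u $ j))) differentiable (at y)"
    by (intro differentiable_compose_DERIV[OF DERIV_ln])
  then show ?thesis
    unfolding cross_entropy_def by (intro differentiable_diff network_differentiable)
qed

section \<open>Proximal minimizers and the gradient of the Moreau envelope\<close>

text \<open>Since \<open>\<rho> * \<sigma> < 1\<close>, the proximal quadratic outweighs the
  concavity permitted to \<open>f\<close>, so the penalized function is strongly convex. The
  midpoint of two distinct minimizers would have a strictly smaller value.\<close>

lemma weakly_convex_prox_minimizer_unique:
  fixes f :: "'a::real_inner \<Rightarrow> real"
  assumes conv: "convex_on Y (\<lambda>y. f y + \<sigma> / 2 * (norm y)\<^sup>2)"
    and "\<rho> > 0" and "\<rho> * \<sigma> < 1"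
    and "z0 \<in> Y" and "z \<in> Y" and "z \<noteq> z0"
    and min: "\<And>z. z \<in> Y \<Longrightarrow> f z0 + 1 / (2 * \<rho>) * (norm (z0 - y))\<^sup>2 \<le> f z + 1 / (2 * \<rho>) * (norm (z - y))\<^sup>2"
  shows "f z0 + 1 / (2 * \<rho>) * (norm (z0 - y))\<^sup>2 < f z + 1 / (2 * \<rho>) * (norm (z - y))\<^sup>2"
proof (rule ccontr)
  define c where "c = 1 / (2 * \<rho>)"
  have "c > \<sigma> / 2" using \<open>\<rho> > 0\<close> \<open>\<rho> * \<sigma> < 1\<close> by (simp add: c_def field_simps)
  define m where "m = (1 / 2) *\<^sub>R z0 + (1 / 2) *\<^sub>R z"
  have "m \<in> Y"
    unfolding m_def using convex_on_imp_convex[OF conv] \<open>z0 \<in> Y\<close> \<open>z \<in> Y\<close> by (intro convexD) auto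
  assume "\<not> ?thesis"
  then have le: "f z + c * (norm (z - y))\<^sup>2 \<le> f z0 + c * (norm (z0 - y))\<^sup>2"
    by (simp add: c_def)
  \<comment> \<open>This and the next identity are the parallelogram law; the deficit is the same
    for every center \<open>y\<close>, so the two quadratics can be compared.\<close>
  have norm_m: "(norm m)\<^sup>2 = (norm z0)\<^sup>2 / 2 + (norm z)\<^sup>2 / 2 - (norm (z - z0))\<^sup>2 / 4"
    unfolding m_def power2_norm_eq_inner by (simp add: inner_simps inner_commute field_simps)
  have norm_my: "(norm (m - y))\<^sup>2 = (norm (z0 - y))\<^sup>2 / 2 + (norm (z - y))\<^sup>2 / 2 - (norm (z - z0))\<^sup>2 / 4"
    unfolding m_def power2_norm_eq_inner by (simp add: inner_simps inner_commute field_simps)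
  have "f m + \<sigma> / 2 * (norm m)\<^sup>2 \<le> 1 / 2 * (f z0 + \<sigma> / 2 * (norm z0)\<^sup>2) + 1 / 2 * (f z + \<sigma> / 2 * (norm z)\<^sup>2)"
    using convex_onD[OF conv, of "1 / 2" z0 z] \<open>z0 \<in> Y\<close> \<open>z \<in> Y\<close> by (simp add: m_def)
  moreover have "\<sigma> / 2 * (norm m)\<^sup>2 = \<sigma> / 2 * (norm z0)\<^sup>2 / 2 + \<sigma> / 2 * (norm z)\<^sup>2 / 2 - \<sigma> / 2 * (norm (z - z0))\<^sup>2 / 4"
    unfolding norm_m by (simp add: algebra_simps)
  moreover have "c * (norm (m - y))\<^sup>2 = c * (norm (z0 - y))\<^sup>2 / 2 + c * (norm (z - y))\<^sup>2 / 2 - c * (norm (z - z0))\<^sup>2 / 4"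
    unfolding norm_my by (simp add: algebra_simps)
  moreover have "f z0 + c * (norm (z0 - y))\<^sup>2 \<le> f m + c * (norm (m - y))\<^sup>2"
    using min[OF \<open>m \<in> Y\<close>] by (simp add: c_def)
  ultimately have "(c - \<sigma> / 2) * (norm (z - z0))\<^sup>2 \<le> 0"
    using le by (simp add: algebra_simps)
  then show False
    using \<open>c > \<sigma> / 2\<close> \<open>z \<noteq> z0\<close> by (simp add: mult_le_0_iff)
qed

text \<open>The outer variables enter the minimized function only through the weights
  \<open>\<omega> (x $ i)\<close> and the quadratic. Differentiating in them never touches
  \<open>l i\<close>, whose continuity gives the joint continuity of the gradient needed for the
  Danskin argument.\<close>

lemma GDERIV_moreau_env_separable:
  fixes \<omega> :: "real \<Rightarrow> real" and c :: real and l :: "'n::finite \<Rightarrow> 'b::euclidean_space \<Rightarrow> real"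
  defines "g \<equiv> \<lambda>(x :: real ^ 'n) y. c * (\<Sum>i\<in>UNIV. \<omega> (x $ i) * l i y)"
  assumes \<omega>: "\<And>t. (\<omega> has_real_derivative \<omega>' t) (at t)" and \<omega>': "continuous_on UNIV \<omega>'"
    and l: "\<And>i. continuous_on Y (l i)"
    and "compact Y" and "z \<in> Y" and "\<rho> > 0"
    and unique: "\<And>z'. z' \<in> Y \<Longrightarrow> z' \<noteq> z \<Longrightarrow>
      g x z + 1 / (2 * \<rho>) * (norm (z - y))\<^sup>2 < g x z' + 1 / (2 * \<rho>) * (norm (z' - y))\<^sup>2"
  shows "GDERIV (\<lambda>(x, y). moreau_env g Y \<rho> x y) (x, y) :>
    (\<chi> i. c * (\<omega>' (x $ i) * l i z), (1 / \<rho>) *\<^sub>R (y - z))"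
proof -
  define f where "f = (\<lambda>w z. g (fst w) z + 1 / (2 * \<rho>) * (norm (z - snd w))\<^sup>2)"
  define G where "G = (\<lambda>(w :: (real ^ 'n) \<times> 'b) z. ((\<chi> i. c * (\<omega>' (fst w $ i) * l i z)) :: real ^ 'n, (1 / \<rho>) *\<^sub>R (snd w - z)))"
  have "GDERIV (\<lambda>w. INF z\<in>Y. f w z) (x, y) :> G (x, y) z"
  proof (rule Danskin_unique_minimizer)
    show "continuous_on Y (f (x, y))"
      unfolding f_def g_def using \<open>\<rho> > 0\<close> by (intro continuous_intros l) auto
    show "continuous_on (UNIV \<times> Y) (\<lambda>(w, z). G w z)"
      unfolding G_def case_prod_unfold
      by (intro continuous_intros continuous_on_vec_lambda continuous_on_compose2[OF \<omega>']
          continuous_on_compose2[OF l]) (use \<open>\<rho> > 0\<close> in auto)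
    show "GDERIV (\<lambda>w. f w z) w :> G w z" for w z
    proof -
      have "((\<lambda>w. \<omega> (fst w $ i)) has_derivative (\<lambda>h. \<omega>' (fst w $ i) * (fst h $ i))) (at w)" for i
      proof (rule has_derivative_compose[OF _ \<omega>[THEN has_field_derivative_imp_has_derivative]])
        show "((\<lambda>w. fst w $ i) has_derivative (\<lambda>h. fst h $ i)) (at w)"
          by (intro bounded_linear_imp_has_derivative bounded_linear_vec_nth[THEN bounded_linear_compose] bounded_linear_fst)
      qed
      note [derivative_intros] = this
      have "((\<lambda>w. f w z) has_derivative (\<lambda>h. c * (\<Sum>i\<in>UNIV. \<omega>' (fst w $ i) * (fst h $ i) * l i z)
          + 1 / (2 * \<rho>) * (2 * ((z - snd w) \<bullet> (- snd h))))) (at w)"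
        unfolding f_def g_def power2_norm_eq_inner
        using \<open>\<rho> > 0\<close> by (auto intro!: derivative_eq_intros simp: inner_commute)
      also have "(\<lambda>h. c * (\<Sum>i\<in>UNIV. \<omega>' (fst w $ i) * (fst h $ i) * l i z)
          + 1 / (2 * \<rho>) * (2 * ((z - snd w) \<bullet> (- snd h)))) = (\<lambda>h. h \<bullet> G w z)"
        by (rule ext) (simp add: G_def inner_prod_def inner_vec_def sum_distrib_left inner_simps 
            inner_commute algebra_simps diff_divide_distrib)
      finally show ?thesis by (simp add: gderiv_def)
    qed
  qed (use assms in \<open>auto simp: f_def\<close>)
  then show ?thesis
    by (simp add: f_def G_def moreau_env_def case_prod_unfold)
qed

section \<open>The constraint qualification on the box times \<open>Y\<close>\<close>

theorem corollary18:
  fixes M B\<^sub>y \<sigma> \<rho> \<delta> :: real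
    and X :: "(real ^ 'n::finite) set"
    and Y :: "('d::finite, 'h::finite, 'm::finite) params set"
    and u :: "'n \<Rightarrow> real ^ 'd"
    and q :: "'n \<Rightarrow> 'm"
    and g :: "real ^ 'n \<Rightarrow> ('d, 'h, 'm) params \<Rightarrow> real"
    and R :: "(real ^ 'n) \<times> ('d, 'h, 'm) params \<Rightarrow> real"
  assumes "M > 0" and "B\<^sub>y > 0"
    and X_def: "X = {x. \<forall>i. x $ i \<in> {-M..M}}"
    and "Y \<noteq> {}" and "compact Y" and "convex Y"
    and bound: "\<And>A a V b. (A, a, V, b) \<in> Y \<Longrightarrow>
           (\<forall>j k. V $ j $ k \<in> {-B\<^sub>y..B\<^sub>y}) \<and> (\<forall>j. b $ j \<in> {-B\<^sub>y..B\<^sub>y})"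
    and g_def: "g = weighted_loss u q"
    and "\<sigma> \<ge> 0"
    and weakly_convex: "\<And>x. x \<in> X \<Longrightarrow> convex_on Y (\<lambda>y. g x y + \<sigma> / 2 * (norm y)\<^sup>2)"
    and "\<rho> > 0" and "\<rho> * \<sigma> < 1"
    and R_def: "R = moreau_gap g Y \<rho> \<delta>"
    and delta: "\<delta> > (2 * B\<^sub>y * (real CARD('h) + 1) + ln (real CARD('m))) / (1 + exp M)"
  shows "ennamcq R (X \<times> Y)"
proof -
  define l where "l = (\<lambda>i (y :: ('d, 'h, 'm) params). cross_entropy (network y (u i)) (q i))"
  define \<omega>' where "\<omega>' = (\<lambda>t. logistic t * (1 - logistic t))"
  have g_eq: "g = (\<lambda>x y. 1 / real CARD('n) * (\<Sum>i\<in>UNIV. logistic (x $ i) * l i y))"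
    by (intro ext) (simp add: g_def weighted_loss_def l_def)
  have \<omega>'_pos: "\<omega>' t > 0" for t
  proof -
    have "logistic t < 1" by (simp add: logistic_def add_pos_pos)
    then show ?thesis by (simp add: \<omega>'_def logistic_pos)
  qed
  have l_diff: "l i differentiable (at y)" for i y
    unfolding l_def by (rule cross_entropy_network_differentiable)
  then have l_cont: "continuous_on Y (l i)" for i
    by (intro differentiable_imp_continuous_on) (auto simp: differentiable_on_def intro: differentiable_at_withinI)
  have l_le: "l i y \<le> 2 * B\<^sub>y * (real CARD('h) + 1) + ln (real CARD('m))" if "y \<in> Y" for i y
  proof -
    obtain A a V b where y: "y = (A, a, V, b)" by (metis prod.exhaust)
    have "\<bar>V $ j $ k\<bar> \<le> B\<^sub>y" "\<bar>b $ j\<bar> \<le> B\<^sub>y" for j k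
      using bound[of A a V b] that by (auto simp: y abs_le_iff minus_le_iff)
    then have "\<bar>network y (u i) $ j\<bar> \<le> B\<^sub>y * (real CARD('h) + 1)" for j
      unfolding y by (rule abs_network_le)
    from cross_entropy_le[OF this] show ?thesis by (simp add: l_def mult.assoc)
  qed
  have "R differentiable (at w) \<and> 0 \<notin> (\<lambda>v. gradient R w + v) ` normal_cone (X \<times> Y) w"
    if "w \<in> X \<times> Y" and "R w \<ge> 0" for w
  proof -
    obtain x y where w: "w = (x, y)" and "x \<in> X" "y \<in> Y" using \<open>w \<in> X \<times> Y\<close> by auto
    define p where "p = (\<lambda>z. g x z + 1 / (2 * \<rho>) * (norm (z - y))\<^sup>2)"
    have "continuous_on Y p"
      unfolding p_def g_eq by (intro continuous_intros l_cont)
    then obtain z where "z \<in> Y" and min: "\<And>z'. z' \<in> Y \<Longrightarrow> p z \<le> p z'"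
      using continuous_attains_inf[OF \<open>compact Y\<close> \<open>Y \<noteq> {}\<close>] by blast
    have env: "moreau_env g Y \<rho> x y = p z"
      unfolding moreau_env_def p_def[symmetric]
      by (rule cInf_eq_minimum) (use \<open>z \<in> Y\<close> min in auto)
    have "p z < p z'" if "z' \<in> Y" "z' \<noteq> z" for z'
      unfolding p_def
      by (rule weakly_convex_prox_minimizer_unique[OF weakly_convex[OF \<open>x \<in> X\<close>] \<open>\<rho> > 0\<close> \<open>\<rho> * \<sigma> < 1\<close> \<open>z \<in> Y\<close> that])
        (use min in \<open>simp add: p_def\<close>)
    then have env_deriv: "GDERIV (\<lambda>(x, y). moreau_env g Y \<rho> x y) (x, y) :>
        (\<chi> i. 1 / real CARD('n) * (\<omega>' (x $ i) * l i z), (1 / \<rho>) *\<^sub>R (y - z))"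
      unfolding g_eq p_def \<omega>'_def
      by (intro GDERIV_moreau_env_separable logistic_DERIV continuous_intros l_cont \<open>compact Y\<close> \<open>z \<in> Y\<close> \<open>\<rho> > 0\<close>) auto
    define E where "E = (\<lambda>h. h \<bullet> (\<chi> i. 1 / real CARD('n) * (\<omega>' (x $ i) * l i z), (1 / \<rho>) *\<^sub>R (y - z)))"
    have "\<forall>i. \<exists>D. (l i has_derivative D) (at y)"
      using l_diff unfolding differentiable_def by blast
    then obtain L where L: "\<And>i. (l i has_derivative L i) (at y)"
      by metis
    \<comment> \<open>The derivatives \<open>L i\<close> in the network parameters can stay
      abstract: \<open>D\<close> is later evaluated only in directions with zero second component,
      where they vanish.\<close>
    define D where "D = (\<lambda>h. 1 / real CARD('n) *
      (\<Sum>i\<in>UNIV. logistic (x $ i) * L i (snd h) + \<omega>' (x $ i) * (fst h $ i) * l i y) - E h)"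
    have "((\<lambda>w. logistic (fst w $ i)) has_derivative (\<lambda>h. \<omega>' (x $ i) * (fst h $ i))) (at (x, y))" for i
    proof -
      have "((\<lambda>w. fst w $ i) has_derivative (\<lambda>h. fst h $ i)) (at (x, y))"
        by (intro bounded_linear_imp_has_derivative bounded_linear_vec_nth[THEN bounded_linear_compose] bounded_linear_fst)
      from has_derivative_compose[OF this logistic_DERIV[THEN has_field_derivative_imp_has_derivative]]
      show ?thesis by (simp add: \<omega>'_def)
    qed
    moreover have "((\<lambda>w. l i (snd w)) has_derivative (\<lambda>h. L i (snd h))) (at (x, y))" for i
      by (rule has_derivative_compose[OF bounded_linear_imp_has_derivative[OF bounded_linear_snd]]) (simp add: L)
    moreover have "((\<lambda>w. moreau_env g Y \<rho> (fst w) (snd w)) has_derivative E) (at (x, y))"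
      using env_deriv by (simp add: gderiv_def E_def case_prod_unfold)
    ultimately have "((\<lambda>w. g (fst w) (snd w) - moreau_env g Y \<rho> (fst w) (snd w) - \<delta>) has_derivative D) (at (x, y))"
      unfolding D_def g_eq by (auto intro!: derivative_eq_intros)
    then have R_deriv: "(R has_derivative D) (at w)"
      by (simp add: R_def moreau_gap_def case_prod_unfold w)
    then obtain v where "GDERIV R w :> v" and v: "\<And>h. h \<bullet> v = D h"
      by (rule GDERIV_exists) blast
    \<comment> \<open>As \<open>v\<close> is the gradient of \<open>R\<close>, zero lies in its sum
      with the normal cone exactly when \<open>- v\<close> is a normal vector. Such a vector is
      tested only at points sharing the component \<open>y\<close>.\<close>
    have "- v \<notin> normal_cone (X \<times> Y) w"
    proof
      assume "- v \<in> normal_cone (X \<times> Y) w"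
      then have stat: "0 \<le> D (x' - x, 0)" if "x' \<in> X" for x'
        using that \<open>y \<in> Y\<close> by (auto simp: normal_cone_def w inner_commute simp flip: v)
          (force simp: inner_commute)
      have L0: "L i 0 = 0" for i
        using L by (metis has_derivative_linear linear_0)
      define M\<^sub>l where "M\<^sub>l = 2 * B\<^sub>y * (real CARD('h) + 1) + ln (real CARD('m))"
      have term_le: "logistic (x $ i) * (l i y - l i z) \<le> M\<^sub>l / (1 + exp M)" for i
      proof (cases "l i y \<le> l i z")
        case True
        \<comment> \<open>The common bound also covers nonpositive terms, since it dominates a
          nonnegative loss.\<close>
        have "M\<^sub>l \<ge> 0" using l_le[OF \<open>y \<in> Y\<close>, of i] cross_entropy_nonneg[of "network y (u i)" "q i"]
          by (simp add: M\<^sub>l_def l_def)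
        then have "0 \<le> M\<^sub>l / (1 + exp M)" by (simp add: add_pos_pos)
        moreover have "logistic (x $ i) * (l i y - l i z) \<le> 0"
          using True logistic_pos[of "x $ i"] by (simp add: mult_le_0_iff)
        ultimately show ?thesis by linarith
      next
        case False
        \<comment> \<open>Only coordinate \<open>i\<close> moves, to the lower end of its interval.
          This isolates one summand of \<open>D\<close>, and a positive loss difference makes its
          sign force \<open>x $ i\<close> to be at that end already.\<close>
        define x' where "x' = x + axis i (- M - x $ i)"
        have "x' \<in> X" using \<open>x \<in> X\<close> \<open>M > 0\<close> by (auto simp: X_def x'_def axis_def)
        have "x' - x = axis i (- M - x $ i)" by (simp add: x'_def)
        moreover have "(\<Sum>j\<in>UNIV. \<omega>' (x $ j) * axis i (- M - x $ i) $ j * l j y) =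
            \<omega>' (x $ i) * (- M - x $ i) * l i y"
          by (simp add: axis_def if_distrib if_distribR cong: if_cong)
        ultimately have "D (x' - x, 0) = 1 / real CARD('n) * (\<omega>' (x $ i) * (- M - x $ i) * (l i y - l i z))"
          by (simp add: D_def E_def L0 inner_axis') (simp add: algebra_simps diff_divide_distrib add_divide_distrib)
        with stat[OF \<open>x' \<in> X\<close>] have "0 \<le> \<omega>' (x $ i) * (- M - x $ i) * (l i y - l i z)"
          by (simp add: zero_le_divide_iff)
        with False \<omega>'_pos[of "x $ i"] have "x $ i \<le> - M"
          by (auto simp: zero_le_mult_iff)
        moreover have "- M \<le> x $ i" using \<open>x \<in> X\<close> by (simp add: X_def)
        ultimately have "x $ i = - M" by simp
        then have "logistic (x $ i) * (l i y - l i z) = (l i y - l i z) / (1 + exp M)"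
          by (simp add: logistic_def)
        also have "\<dots> \<le> M\<^sub>l / (1 + exp M)"
          using l_le[OF \<open>y \<in> Y\<close>, of i] cross_entropy_nonneg[of "network z (u i)" "q i"]
          by (intro divide_right_mono) (auto simp: M\<^sub>l_def l_def add_nonneg_nonneg)
        finally show ?thesis .
      qed
      have "g x y - g x z = 1 / real CARD('n) * (\<Sum>i\<in>UNIV. logistic (x $ i) * (l i y - l i z))"
        by (simp add: g_eq sum_subtractf right_diff_distrib diff_divide_distrib)
      also have "\<dots> \<le> 1 / real CARD('n) * (real CARD('n) * (M\<^sub>l / (1 + exp M)))"
        using term_le by (intro mult_left_mono sum_bounded_above) auto
      also have "\<dots> < \<delta>" using delta by (simp add: M\<^sub>l_def)
      finally have "g x y - g x z < \<delta>" .
      moreover have "g x y - p z - \<delta> \<ge> 0"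
        using \<open>R w \<ge> 0\<close> by (simp add: R_def moreau_gap_def w env)
      \<comment> \<open>The proximal penalty is nonnegative, so a gap to the envelope of at least
        \<open>\<delta>\<close> is also a gap to \<open>g x z\<close>.\<close>
      moreover have "p z \<ge> g x z" using \<open>\<rho> > 0\<close> by (simp add: p_def)
      ultimately show False by linarith
    qed
    then have "v + v' \<noteq> 0" if "v' \<in> normal_cone (X \<times> Y) w" for v'
      using that by (metis add_eq_0_iff)
    with gradient_eqI[OF \<open>GDERIV R w :> v\<close>] have "0 \<notin> (\<lambda>v. gradient R w + v) ` normal_cone (X \<times> Y) w"
      by force
    with R_deriv show ?thesis
      by (auto simp: differentiable_def)
  qed
  then show ?thesis unfolding ennamcq_def by blast
qed

end
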